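(* Let $(W,S)$ be a Coxeter system with $S$ finite and suppose that $W=W_{S_1}\times W_{S_2}$ is the (internal) direct product of the parabolic subgroups $W_{S_1}$ and $W_{S_2}$, where $S_1,S_2\subset S$. Suppose that $W$ acts geometrically on a CAT(0) space $X$. Then the subgroups $W_{S_1}$ and $W_{S_2}$ are convex-cocompact (with respect to the action on $X$).
   Context: A Coxeter group is a group $W$ having a presentation $\langle S \mid (st)^{m(s,t)}=1 \text{ for } s,t\in S\rangle$, where $S$ is a finite set and $m:S\times S\to \mathbb{N}\cup\{\infty\}$ satisfies: (1) $m(s,t)=m(t,s)$ for all $s,t\in S$; (2) $m(s,s)=1$ for all $s\in S$; (3) $m(s,t)\ge 2$ for all $s\ne t$ in $S$ (no relation is imposed when $m(s,t)=\infty$). The pair $(W,S)$ is called a Coxeter system. For $T\subset S$, the parabolic subgroup $W_T$ is the subgroup of $W$ generated by $T$. A group acts geometrically on a (nonempty) metric space $X$ if it acts by isometries, properly discontinuously (each $x\in X$ has a ball $B(x,r)$, $r>0$, such that only finitely many group elements $g$ satisfy $gB(x,r)\cap B(x,r)\neq\emptyset$) and cocompactly. If a group $G$ acts geometrically on a CAT(0) space $X$, a subgroup $H\le G$ is convex-cocompact if there exists a nonempty closed convex $H$-invariant subset $Y\subset X$ on which $H$ acts cocompactly. *)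

theory Defs
  imports
    "HOL-Analysis.Analysis"
    "HOL-Algebra.Generated_Groups"
    "HOL-Algebra.Group_Action"
    "HOL-Library.Extended_Nat"
begin

section \<open>Presentations and Coxeter systems\<close>

text \<open>
  A word over \<open>S\<close> is a list of signed letters: \<open>(s, True)\<close> stands for \<open>s\<close> and
  \<open>(s, False)\<close> for the formal inverse of \<open>s\<close>.
\<close>

definition signed_words :: "'a set \<Rightarrow> ('a \<times> bool) list set" where
  "signed_words S = lists (S \<times> UNIV)"

inductive word_eq :: "'a set \<Rightarrow> ('a \<times> bool) list set \<Rightarrow>
    ('a \<times> bool) list \<Rightarrow> ('a \<times> bool) list \<Rightarrow> bool"
  for S R where
  refl: "w \<in> signed_words S \<Longrightarrow> word_eq S R w w"
| sym: "word_eq S R u v \<Longrightarrow> word_eq S R v u"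
| trans: "word_eq S R u v \<Longrightarrow> word_eq S R v w \<Longrightarrow> word_eq S R u w"
| cancel: "s \<in> S \<Longrightarrow> u \<in> signed_words S \<Longrightarrow> v \<in> signed_words S \<Longrightarrow>
    word_eq S R (u @ [(s, b), (s, \<not> b)] @ v) (u @ v)"
| relator: "r \<in> R \<Longrightarrow> r \<in> signed_words S \<Longrightarrow> u \<in> signed_words S \<Longrightarrow> v \<in> signed_words S \<Longrightarrow>
    word_eq S R (u @ r @ v) (u @ v)"

definition word_rel :: "'a set \<Rightarrow> ('a \<times> bool) list set \<Rightarrow>
    (('a \<times> bool) list \<times> ('a \<times> bool) list) set" where
  "word_rel S R = {(u, v). word_eq S R u v}"

text \<open>The group \<open>\<langle>S | R\<rangle>\<close>; its elements are the classes of words modulo \<^term>\<open>word_rel S R\<close>.\<close>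

definition presented_group :: "'a set \<Rightarrow> ('a \<times> bool) list set \<Rightarrow>
    ('a \<times> bool) list set monoid" where
  "presented_group S R =
    \<lparr>carrier = signed_words S // word_rel S R,
     mult = (\<lambda>A B. \<Union>u\<in>A. \<Union>v\<in>B. word_rel S R `` {u @ v}),
     one = word_rel S R `` {[]}\<rparr>"

text \<open>\<open>G\<close> has the presentation \<open>\<langle>S | R\<rangle>\<close>, where the generators are elements of \<open>G\<close> itself.\<close>

definition has_presentation ::
    "('a, 'b) monoid_scheme \<Rightarrow> 'a set \<Rightarrow> ('a \<times> bool) list set \<Rightarrow> bool" where
  "has_presentation G S R \<longleftrightarrow>
    S \<subseteq> carrier G \<and>
    (\<exists>h \<in> iso (presented_group S R) G. \<forall>s\<in>S. h (word_rel S R `` {[(s, True)]}) = s)"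

definition coxeter_matrix :: "'a set \<Rightarrow> ('a \<Rightarrow> 'a \<Rightarrow> enat) \<Rightarrow> bool" where
  "coxeter_matrix S m \<longleftrightarrow>
    (\<forall>s\<in>S. \<forall>t\<in>S. m s t = m t s) \<and>
    (\<forall>s\<in>S. m s s = 1) \<and>
    (\<forall>s\<in>S. \<forall>t\<in>S. s \<noteq> t \<longrightarrow> m s t \<ge> 2)"

text \<open>The words \<open>(st)\<^bsup>m(s,t)\<^esup>\<close> with \<open>m(s,t)\<close> finite.\<close>

definition coxeter_relators :: "'a set \<Rightarrow> ('a \<Rightarrow> 'a \<Rightarrow> enat) \<Rightarrow> ('a \<times> bool) list set" where
  "coxeter_relators S m =
    {concat (replicate n [(s, True), (t, True)]) | s t n. s \<in> S \<and> t \<in> S \<and> m s t = enat n}"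

definition coxeter_system :: "('a, 'b) monoid_scheme \<Rightarrow> 'a set \<Rightarrow> bool" where
  "coxeter_system W S \<longleftrightarrow>
    group W \<and> finite S \<and>
    (\<exists>m. coxeter_matrix S m \<and> has_presentation W S (coxeter_relators S m))"

definition parabolic :: "('a, 'b) monoid_scheme \<Rightarrow> 'a set \<Rightarrow> 'a set" where
  "parabolic W T = generate W T"

definition internal_direct_product ::
    "('a, 'b) monoid_scheme \<Rightarrow> 'a set \<Rightarrow> 'a set \<Rightarrow> bool" where
  "internal_direct_product G H K \<longleftrightarrow>
    subgroup H G \<and> subgroup K G \<and>
    (\<lambda>(h, k). h \<otimes>\<^bsub>G\<^esub> k) \<in> iso (G\<lparr>carrier := H\<rparr> \<times>\<times> G\<lparr>carrier := K\<rparr>) G"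


section \<open>CAT(0) spaces\<close>

text \<open>Metric spaces are subsets \<open>X\<close> of a type of class \<^class>\<open>metric_space\<close>, with the induced metric.\<close>

definition geodesic_segment :: "'x::metric_space set \<Rightarrow> 'x \<Rightarrow> 'x \<Rightarrow> 'x set \<Rightarrow> bool" where
  "geodesic_segment X x y A \<longleftrightarrow>
    (\<exists>c. c 0 = x \<and> c (dist x y) = y \<and>
         (\<forall>s\<in>{0..dist x y}. \<forall>t\<in>{0..dist x y}. dist (c s) (c t) = \<bar>s - t\<bar>) \<and>
         A = c ` {0..dist x y} \<and> A \<subseteq> X)"

definition geodesic_space :: "'x::metric_space set \<Rightarrow> bool" where
  "geodesic_space X \<longleftrightarrow> (\<forall>x\<in>X. \<forall>y\<in>X. \<exists>A. geodesic_segment X x y A)"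

text \<open>
  \<open>x'\<close> is the point of the Euclidean segment \<open>[p', q']\<close> corresponding to the point \<open>x\<close> of the
  geodesic segment \<open>A\<close> that starts at \<open>p\<close>.
\<close>

definition comparison_point ::
    "'x::metric_space \<Rightarrow> 'x set \<Rightarrow> real^2 \<Rightarrow> real^2 \<Rightarrow> 'x \<Rightarrow> real^2 \<Rightarrow> bool" where
  "comparison_point p A p' q' x x' \<longleftrightarrow>
    x \<in> A \<and> x' \<in> closed_segment p' q' \<and> dist p' x' = dist p x"

text \<open>
  In the CAT(0) inequality the triangle has vertices \<open>p, q, r\<close> and sides \<open>A = [p, q]\<close>,
  \<open>B = [q, r]\<close>, \<open>C = [r, p]\<close>, and its comparison triangle has vertices \<open>p', q', r'\<close>.
\<close>

definition CAT0 :: "'x::metric_space set \<Rightarrow> bool" where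
  "CAT0 X \<longleftrightarrow>
    geodesic_space X \<and>
    (\<forall>p q r A B C. \<forall>p' q' r' :: real^2.
      geodesic_segment X p q A \<longrightarrow> geodesic_segment X q r B \<longrightarrow> geodesic_segment X r p C \<longrightarrow>
      dist p' q' = dist p q \<longrightarrow> dist q' r' = dist q r \<longrightarrow> dist r' p' = dist r p \<longrightarrow>
      (let corresponds = (\<lambda>x x'. comparison_point p A p' q' x x' \<or>
                                 comparison_point q B q' r' x x' \<or>
                                 comparison_point r C r' p' x x')
       in \<forall>x y x' y'. corresponds x x' \<longrightarrow> corresponds y y' \<longrightarrow> dist x y \<le> dist x' y'))"

definition geodesically_convex :: "'x::metric_space set \<Rightarrow> 'x set \<Rightarrow> bool" where
  "geodesically_convex X Y \<longleftrightarrow>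
    Y \<subseteq> X \<and> (\<forall>x\<in>Y. \<forall>y\<in>Y. \<forall>A. geodesic_segment X x y A \<longrightarrow> A \<subseteq> Y)"


section \<open>Geometric actions and convex-cocompact subgroups\<close>

definition properly_discontinuous ::
    "('a, 'b) monoid_scheme \<Rightarrow> 'x::metric_space set \<Rightarrow> ('a \<Rightarrow> 'x \<Rightarrow> 'x) \<Rightarrow> bool" where
  "properly_discontinuous G X \<phi> \<longleftrightarrow>
    (\<forall>x\<in>X. \<exists>r>0. finite {g \<in> carrier G. \<phi> g ` (X \<inter> ball x r) \<inter> (X \<inter> ball x r) \<noteq> {}})"

text \<open>
  Cocompactness of \<open>H\<close> on \<open>Y\<close> means that \<open>Y\<close> is covered by the translates of a compact subset; for
  the properly discontinuous actions considered here this is the same as compactness of the quotient \<open>Y/H\<close>.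
\<close>

definition cocompact_on :: "'a set \<Rightarrow> 'x::metric_space set \<Rightarrow> ('a \<Rightarrow> 'x \<Rightarrow> 'x) \<Rightarrow> bool" where
  "cocompact_on H Y \<phi> \<longleftrightarrow> (\<exists>K. compact K \<and> K \<subseteq> Y \<and> (\<Union>h\<in>H. \<phi> h ` K) = Y)"

definition acts_geometrically ::
    "('a, 'b) monoid_scheme \<Rightarrow> 'x::metric_space set \<Rightarrow> ('a \<Rightarrow> 'x \<Rightarrow> 'x) \<Rightarrow> bool" where
  "acts_geometrically G X \<phi> \<longleftrightarrow>
    X \<noteq> {} \<and> group_action G X \<phi> \<and>
    (\<forall>g\<in>carrier G. \<forall>x\<in>X. \<forall>y\<in>X. dist (\<phi> g x) (\<phi> g y) = dist x y) \<and>
    properly_discontinuous G X \<phi> \<and>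
    cocompact_on (carrier G) X \<phi>"

definition convex_cocompact ::
    "('a, 'b) monoid_scheme \<Rightarrow> 'x::metric_space set \<Rightarrow> ('a \<Rightarrow> 'x \<Rightarrow> 'x) \<Rightarrow> 'a set \<Rightarrow> bool" where
  "convex_cocompact G X \<phi> H \<longleftrightarrow>
    subgroup H G \<and>
    (\<exists>Y. Y \<subseteq> X \<and> Y \<noteq> {} \<and> closedin (top_of_set X) Y \<and> geodesically_convex X Y \<and>
         (\<forall>h\<in>H. \<phi> h ` Y = Y) \<and> cocompact_on H Y \<phi>)"

end

theory Submission
  imports Defs
begin

text \<open>
  Let \<open>T = S\<^sub>2\<close>. The set \<open>Y = {x. \<forall>s\<in>T. dist x (s x) \<le> R}\<close> is closed, it is convex since
  displacement functions are convex in a CAT(0) space, and it is invariant under the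
  centralizer of \<open>T\<close>. That centralizer acts cocompactly on \<open>Y\<close>: if \<open>x = g k\<close> lies in
  \<open>Y\<close> with \<open>k\<close> in a compact fundamental set, then only finitely many tuples
  \<open>(g\<^sup>-\<^sup>1 s g)\<close> are possible, and elements \<open>g\<close> with equal tuples differ by an element
  of the centralizer. In \<open>W = W\<^sub>1 \<times> W\<^sub>2\<close> the centralizer of \<open>S\<^sub>2\<close> is \<open>W\<^sub>1\<close> times a
  subgroup of the center of \<open>W\<close>, so it remains to see that a Coxeter group has finite center.

  Sending a word to its set of inversions defines a cocycle on \<open>W\<close> with values in the
  subsets of \<open>W\<close> under symmetric difference, and by the exchange condition only the identity
  has no inversion in \<open>S\<close>. On the center the conjugation action is trivial, so the cocycle
  restricts to a homomorphism and embeds the center into the subsets of \<open>S\<close>.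
\<close>

section \<open>The center of a Coxeter group\<close>

context group
begin

primrec word_prod :: "'a list \<Rightarrow> 'a" where
  "word_prod [] = \<one>"
| "word_prod (x # w) = x \<otimes> word_prod w"

text \<open>
  For involutive letters, these are the elements occurring an odd number of times among the
  reflections \<open>x\<^sub>1 \<dots> x\<^sub>i\<^sub>-\<^sub>1 x\<^sub>i x\<^sub>i\<^sub>-\<^sub>1 \<dots> x\<^sub>1\<close> of the word.
\<close>

primrec inversions :: "'a list \<Rightarrow> 'a set" where
  "inversions [] = {}"
| "inversions (x # w) = {r \<in> carrier G. (r = x) \<noteq> (inv x \<otimes> r \<otimes> x \<in> inversions w)}"

lemma word_prod_closed [simp]: "set w \<subseteq> carrier G \<Longrightarrow> word_prod w \<in> carrier G"
  by (induction w) auto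

lemma word_prod_append:
  "set u \<subseteq> carrier G \<Longrightarrow> set v \<subseteq> carrier G \<Longrightarrow> word_prod (u @ v) = word_prod u \<otimes> word_prod v"
  by (induction u) (auto simp: m_assoc)

lemma inversions_subset: "inversions w \<subseteq> carrier G"
  by (cases w) auto

text \<open>This is the cocycle identity: the reflections contributed by \<open>v\<close> are
  conjugated by the prefix \<open>u\<close>, and parities add, so \<open>\<noteq>\<close> between
  truth values expresses symmetric difference.\<close>

lemma mem_inversions_append:
  assumes "set u \<subseteq> carrier G" "set v \<subseteq> carrier G" "r \<in> carrier G"
  shows "r \<in> inversions (u @ v) \<longleftrightarrow>
    (r \<in> inversions u) \<noteq> (inv (word_prod u) \<otimes> r \<otimes> word_prod u \<in> inversions v)"
  using assms
proof (induction u arbitrary: r)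
  case (Cons x u)
  then have "inv (word_prod (x # u)) \<otimes> r \<otimes> word_prod (x # u) =
      inv (word_prod u) \<otimes> (inv x \<otimes> r \<otimes> x) \<otimes> word_prod u"
    by (simp add: inv_mult_group m_assoc)
  with Cons show ?case
    by auto
qed simp

text \<open>An element of odd multiplicity occurs at least once among the reflections, say at the
  letter \<open>y\<close> after the prefix \<open>a\<close>, and is then the conjugate of
  \<open>y\<close> by \<open>a\<close>. This is the input to the exchange condition.\<close>

lemma inversions_split:
  assumes "set w \<subseteq> carrier G" "r \<in> inversions w"
  shows "\<exists>a y b. w = a @ y # b \<and> r \<otimes> word_prod a = word_prod a \<otimes> y"
  using assms
proof (induction w arbitrary: r)
  case (Cons x w)
  show ?case
  proof (cases "r = x")
    case True
    then have "x # w = [] @ x # w \<and> r \<otimes> word_prod [] = word_prod [] \<otimes> x"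
      using Cons.prems by auto
    then show ?thesis by blast
  next
    case False
    with Cons.prems have r: "r \<in> carrier G" "inv x \<otimes> r \<otimes> x \<in> inversions w"
      by auto
    with Cons obtain a y b where ab: "w = a @ y # b"
      "inv x \<otimes> r \<otimes> x \<otimes> word_prod a = word_prod a \<otimes> y"
      by force
    have cl: "x \<in> carrier G" "word_prod a \<in> carrier G" "y \<in> carrier G"
      using Cons.prems ab by auto
    have "r \<otimes> (x \<otimes> word_prod a) = x \<otimes> (inv x \<otimes> r \<otimes> x \<otimes> word_prod a)"
      using cl r m_assoc[of x "inv x" "r \<otimes> (x \<otimes> word_prod a)"] by (simp add: m_assoc)
    also have "\<dots> = x \<otimes> word_prod a \<otimes> y"
      using ab cl by (simp add: m_assoc)
    finally have "x # w = (x # a) @ y # b \<and> r \<otimes> word_prod (x # a) = word_prod (x # a) \<otimes> y"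
      using ab by simp
    then show ?thesis by blast
  qed
qed simp

end

section \<open>Alternating words and the dihedral relators\<close>

fun alternating :: "'a \<Rightarrow> 'a \<Rightarrow> nat \<Rightarrow> 'a list" where
  "alternating s t 0 = []"
| "alternating s t (Suc k) = s # alternating t s k"

lemma alternating_double: "concat (replicate n [s, t]) = alternating s t (n + n)"
  by (induction n) auto

context group
begin

text \<open>Conjugation by \<open>s\<close> carries the reflection with index \<open>j\<close> of
  the alternating word starting with \<open>t\<close> to the one with index \<open>Suc j\<close> of
  the word starting with \<open>s\<close>.\<close>

lemma conj_alternating:
  assumes "s \<in> carrier G" "t \<in> carrier G"
  shows "s \<otimes> ((t \<otimes> s) [^] (j::nat) \<otimes> t) \<otimes> s = (s \<otimes> t) [^] Suc j \<otimes> s"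
proof -
  have "s \<otimes> (t \<otimes> s) [^] j = (s \<otimes> t) [^] j \<otimes> s"
  proof (induction j)
    case (Suc j)
    have "s \<otimes> (t \<otimes> s) [^] Suc j = (s \<otimes> (t \<otimes> s) [^] j) \<otimes> (t \<otimes> s)"
      using assms by (simp add: m_assoc)
    with Suc show ?case
      using assms by (simp add: m_assoc)
  qed (use assms in simp)
  then have "(s \<otimes> (t \<otimes> s) [^] j) \<otimes> t \<otimes> s = ((s \<otimes> t) [^] j \<otimes> s) \<otimes> t \<otimes> s"
    by simp
  then show ?thesis
    using assms by (simp add: m_assoc)
qed

text \<open>The sum is the multiplicity of \<open>r\<close> among the reflections. Removing the
  first letter exchanges \<open>s\<close> and \<open>t\<close>, and \<open>conj_alternating\<close>
  shifts the indices of the remaining reflections by one.\<close>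

lemma mem_inversions_alternating:
  assumes "s \<in> carrier G" "t \<in> carrier G" "s \<otimes> s = \<one>" "t \<otimes> t = \<one>" "r \<in> carrier G"
  shows "r \<in> inversions (alternating s t k) \<longleftrightarrow>
    odd (\<Sum>j<k. of_bool ((s \<otimes> t) [^] j \<otimes> s = r) :: nat)"
  using assms
proof (induction s t k arbitrary: r rule: alternating.induct)
  case (2 s t k)
  have inv_s: "inv s = s"
    using 2 by (simp add: inv_equality)
  have eq: "(t \<otimes> s) [^] j \<otimes> t = s \<otimes> r \<otimes> s \<longleftrightarrow> (s \<otimes> t) [^] Suc j \<otimes> s = r" for j :: nat
  proof -
    have "a = s \<otimes> r \<otimes> s \<longleftrightarrow> s \<otimes> a \<otimes> s = r" if "a \<in> carrier G" for a
      using 2 that inv_s inv_solve_left inv_solve_right m_closed m_assoc by metis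
    then show ?thesis
      using conj_alternating[of s t j] 2 by simp
  qed
  have "(\<Sum>j<Suc k. of_bool ((s \<otimes> t) [^] j \<otimes> s = r) :: nat) =
      of_bool (s = r) + (\<Sum>j<k. of_bool ((t \<otimes> s) [^] j \<otimes> t = s \<otimes> r \<otimes> s))"
    unfolding sum.lessThan_Suc_shift eq using 2 by simp
  moreover have "r \<in> inversions (alternating s t (Suc k)) \<longleftrightarrow>
      (r = s) \<noteq> (s \<otimes> r \<otimes> s \<in> inversions (alternating t s k))"
    using 2 inv_s by simp
  moreover have "s \<otimes> r \<otimes> s \<in> inversions (alternating t s k) \<longleftrightarrow>
    odd (\<Sum>j<k. of_bool ((t \<otimes> s) [^] j \<otimes> t = s \<otimes> r \<otimes> s) :: nat)"
    using 2 by simp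
  ultimately show ?case
    by auto
qed simp

text \<open>
  In the dihedral word of length \<open>2n\<close> the \<open>j\<close>-th reflection is \<open>(st)\<^sup>j s\<close>, so if
  \<open>(st)\<^sup>n = 1\<close> every reflection occurs twice as often as in the first half.
\<close>

lemma inversions_relator:
  assumes "s \<in> carrier G" "t \<in> carrier G" "s \<otimes> s = \<one>" "t \<otimes> t = \<one>" "(s \<otimes> t) [^] n = \<one>"
  shows "inversions (concat (replicate n [s, t])) = {}"
proof -
  have "r \<notin> inversions (alternating s t (n + n))" if r: "r \<in> carrier G" for r
  proof -
    let ?P = "\<lambda>j. of_bool ((s \<otimes> t) [^] j \<otimes> s = r) :: nat"
    have "?P (n + j) = ?P j" for j
      using assms by (simp add: nat_pow_mult[symmetric])
    then have "(\<Sum>j<n + n. ?P j) = (\<Sum>j<n. ?P j) + (\<Sum>j<n. ?P j)"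
      using sum.nat_diff_reindex sum.atLeastLessThan_concat[of 0 n "n+n" ?P]
        sum.shift_bounds_nat_ivl[of ?P 0 n n] by (simp add: lessThan_atLeast0 add.commute)
    then show ?thesis
      using mem_inversions_alternating[OF assms(1-4) r, of "n + n"] by simp
  qed
  then show ?thesis
    unfolding alternating_double using inversions_subset by blast
qed

end

section \<open>Words modulo relators and the presented group\<close>

lemma word_eq_signed_words:
  "word_eq S R u v \<Longrightarrow> u \<in> signed_words S \<and> v \<in> signed_words S"
  by (induction rule: word_eq.induct) (auto simp: signed_words_def)

lemma word_eq_append_right:
  "word_eq S R u v \<Longrightarrow> w \<in> signed_words S \<Longrightarrow> word_eq S R (u @ w) (v @ w)"
proof (induction rule: word_eq.induct)
  case (cancel s u v b)
  then show ?case
    using word_eq.cancel[of s S u "v @ w" R b] by (simp add: signed_words_def)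
next
  case (relator r u v)
  then show ?case
    using word_eq.relator[of r R S u "v @ w"] by (simp add: signed_words_def)
qed (auto intro: word_eq.intros simp: signed_words_def)

lemma word_eq_append_left:
  "word_eq S R u v \<Longrightarrow> w \<in> signed_words S \<Longrightarrow> word_eq S R (w @ u) (w @ v)"
proof (induction rule: word_eq.induct)
  case (cancel s u v b)
  then show ?case
    using word_eq.cancel[of s S "w @ u" v R b] by (simp add: signed_words_def)
next
  case (relator r u v)
  then show ?case
    using word_eq.relator[of r R S "w @ u" v] by (simp add: signed_words_def)
qed (auto intro: word_eq.intros simp: signed_words_def)

lemma equiv_word_rel: "equiv (signed_words S) (word_rel S R)"
  unfolding equiv_def refl_on_def sym_def trans_def word_rel_def
  using word_eq_signed_words by (auto intro: word_eq.intros)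

text \<open>The product is defined as a union over all representatives. The congruence is compatible
  with concatenation on both sides, so all members of that union coincide.\<close>

lemma presented_group_mult_classes:
  assumes "u \<in> signed_words S" "v \<in> signed_words S"
  shows "word_rel S R `` {u} \<otimes>\<^bsub>presented_group S R\<^esub> word_rel S R `` {v} = word_rel S R `` {u @ v}"
proof -
  have "congruent2 (word_rel S R) (word_rel S R) (\<lambda>u v. word_rel S R `` {u @ v})"
  proof (rule congruent2I[OF equiv_word_rel equiv_word_rel])
    fix u v w assume "(u, v) \<in> word_rel S R" "w \<in> signed_words S"
    then show "word_rel S R `` {u @ w} = word_rel S R `` {v @ w}"
      by (intro equiv_class_eq[OF equiv_word_rel]) (simp add: word_rel_def word_eq_append_right)
  next
    fix u v w assume "(u, v) \<in> word_rel S R" "w \<in> signed_words S"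
    then show "word_rel S R `` {w @ u} = word_rel S R `` {w @ v}"
      by (intro equiv_class_eq[OF equiv_word_rel]) (simp add: word_rel_def word_eq_append_left)
  qed
  from UN_equiv_class2[OF equiv_word_rel equiv_word_rel this assms] show ?thesis
    by (simp add: presented_group_def)
qed

section \<open>Inversion sets of elements of a Coxeter group, and its center\<close>

locale coxeter_group = group W for W :: "('w, 'b) monoid_scheme" (structure) +
  fixes S :: "'w set" and m :: "'w \<Rightarrow> 'w \<Rightarrow> enat" and h :: "('w \<times> bool) list set \<Rightarrow> 'w"
  assumes finite_S: "finite S" and S_closed: "S \<subseteq> carrier W"
    and cox_matrix: "coxeter_matrix S m"
    and h_iso: "h \<in> iso (presented_group S (coxeter_relators S m)) W"
    and h_generator: "s \<in> S \<Longrightarrow> h (word_rel S (coxeter_relators S m) `` {[(s, True)]}) = s"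
begin

definition word_value :: "('w \<times> bool) list \<Rightarrow> 'w" where
  "word_value u = h (word_rel S (coxeter_relators S m) `` {u})"

lemma word_value_append:
  assumes "u \<in> signed_words S" "v \<in> signed_words S"
  shows "word_value (u @ v) = word_value u \<otimes> word_value v"
proof -
  have "word_rel S R `` {w} \<in> carrier (presented_group S R)" if "w \<in> signed_words S" for w R
    using that by (auto simp: presented_group_def intro: quotientI)
  moreover have "h \<in> hom (presented_group S (coxeter_relators S m)) W"
    using h_iso by (simp add: iso_def)
  ultimately show ?thesis
    using assms unfolding word_value_def presented_group_mult_classes[OF assms, symmetric]
    by (simp add: hom_mult)
qed

lemma word_value_closed:
  assumes "u \<in> signed_words S"
  shows "word_value u \<in> carrier W"
proof -
  have "word_rel S R `` {u} \<in> carrier (presented_group S R)" for R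
    using assms by (auto simp: presented_group_def intro: quotientI)
  then show ?thesis
    using h_iso unfolding word_value_def iso_def hom_def by auto
qed

text \<open>Injectivity of \<open>h\<close> enters here: words with the same value are linked by
  elementary moves, so an invariant of these moves descends to \<open>W\<close>.\<close>

lemma word_value_eq_iff:
  assumes "u \<in> signed_words S" "v \<in> signed_words S"
  shows "word_value u = word_value v \<longleftrightarrow> word_eq S (coxeter_relators S m) u v"
proof -
  let ?R = "word_rel S (coxeter_relators S m)"
  have "?R `` {w} \<in> carrier (presented_group S (coxeter_relators S m))"
    if "w \<in> signed_words S" for w
    using that by (auto simp: presented_group_def intro: quotientI)
  moreover have "inj_on h (carrier (presented_group S (coxeter_relators S m)))"
    using h_iso by (simp add: iso_def bij_betw_def)
  ultimately have "word_value u = word_value v \<longleftrightarrow> ?R `` {u} = ?R `` {v}"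
    using assms unfolding word_value_def by (simp add: inj_on_eq_iff)
  also have "\<dots> \<longleftrightarrow> (u, v) \<in> ?R"
    using eq_equiv_class_iff[OF equiv_word_rel] assms by blast
  finally show ?thesis
    by (simp add: word_rel_def)
qed

lemma word_value_Nil: "word_value [] = \<one>"
proof -
  have nil: "[] \<in> signed_words S"
    by (simp add: signed_words_def)
  show ?thesis
    using word_value_append[OF nil nil] word_value_closed[OF nil] by simp
qed

lemma generator_square:
  assumes "s \<in> S"
  shows "s \<otimes> s = \<one>"
proof -
  let ?s = "[(s, True)]"
  have words: "?s \<in> signed_words S" "[] \<in> signed_words S" "[(s, True), (s, True)] \<in> signed_words S"
    using assms by (auto simp: signed_words_def)
  \<comment> \<open>The diagonal entry \<open>m s s = 1\<close> contributes this relator.\<close>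
  have "[(s, True), (s, True)] \<in> coxeter_relators S m"
    using assms cox_matrix unfolding coxeter_relators_def coxeter_matrix_def one_enat_def
    by (intro CollectI exI[of _ s] exI[of _ s] exI[of _ 1]) auto
  from word_eq.relator[OF this words(3,2,2)]
  have "word_value (?s @ ?s) = word_value []"
    using words by (subst word_value_eq_iff) (auto simp: signed_words_def)
  then show ?thesis
    using word_value_append[OF words(1,1)] assms
    by (simp add: word_value_Nil) (simp add: word_value_def h_generator)
qed

lemma inv_generator: "s \<in> S \<Longrightarrow> inv s = s"
  using S_closed generator_square by (auto intro: inv_equality)

text \<open>Generators are involutions, so the sign of a letter does not affect its value; hence
  signed words may be replaced by their images under \<open>map fst\<close>.\<close>

lemma word_value_letter:
  assumes "s \<in> S"
  shows "word_value [(s, b)] = s"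
proof -
  have T: "word_value [(s, True)] = s"
    using assms by (simp add: word_value_def h_generator)
  have words: "[(s, b)] \<in> signed_words S" for b
    using assms by (simp add: signed_words_def)
  have "word_eq S (coxeter_relators S m) ([] @ [(s, True), (s, \<not> True)] @ []) ([] @ [])"
    using assms by (intro word_eq.cancel) (auto simp: signed_words_def)
  then have "word_value ([(s, True)] @ [(s, False)]) = word_value []"
    by (subst word_value_eq_iff) (use assms in \<open>auto simp: signed_words_def\<close>)
  then have "s \<otimes> word_value [(s, False)] = \<one>"
    using word_value_append[OF words words] T word_value_Nil by simp
  then have "word_value [(s, False)] = s"
    using word_value_closed[OF words] inv_generator[OF assms] S_closed assms
      inv_equality inv_comm by (metis subsetD)
  with T show ?thesis
    by (cases b) auto
qed

lemma word_value_eq_word_prod: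
  "u \<in> signed_words S \<Longrightarrow> word_value u = word_prod (map fst u)"
proof (induction u)
  case (Cons x u)
  then have "word_value ([x] @ u) = word_value [x] \<otimes> word_value u"
    by (intro word_value_append) (auto simp: signed_words_def)
  with Cons show ?case
    by (cases x) (auto simp: word_value_letter signed_words_def)
qed (simp add: word_value_Nil)

text \<open>Each move deletes a subword with trivial product. By the cocycle identity such a
  deletion is harmless once the subword has no inversions, which is checked for \<open>s s\<close>
  and for the relators.\<close>

lemma word_eq_inversions:
  assumes "word_eq S (coxeter_relators S m) u v"
  shows "inversions (map fst u) = inversions (map fst v)"
  using assms
proof (induction rule: word_eq.induct)
  have eqI: "A = B" if "A \<subseteq> carrier W" "B \<subseteq> carrier W" "\<And>r. r \<in> carrier W \<Longrightarrow> r \<in> A \<longleftrightarrow> r \<in> B" for A B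
    using that by blast
  have drop: "inversions (a @ c @ b) = inversions (a @ b)"
    if "set a \<subseteq> S" "set b \<subseteq> S" "set c \<subseteq> S" "word_prod c = \<one>" "inversions c = {}" for a b c
  proof (rule eqI[OF inversions_subset inversions_subset])
    fix r assume "r \<in> carrier W"
    moreover have cl: "set a \<subseteq> carrier W" "set b \<subseteq> carrier W" "set c \<subseteq> carrier W"
      using that S_closed by auto
    ultimately show "r \<in> inversions (a @ c @ b) \<longleftrightarrow> r \<in> inversions (a @ b)"
      using that by (simp add: mem_inversions_append)
  qed
  {
    case (cancel s u v b)
    have s: "s \<in> carrier W"
      using cancel S_closed by auto
    \<comment> \<open>Both reflections of the word \<open>s s\<close> equal \<open>s\<close>, so
      they cancel modulo two.\<close>
    have "s \<otimes> r \<otimes> s = s \<longleftrightarrow> r = s" if "r \<in> carrier W" for r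
      using that s generator_square[OF cancel(1)] r_one l_one m_assoc m_closed
      by metis
    then have "inversions [s, s] = {}"
      using inv_generator[OF cancel(1)] by auto
    moreover have "set (map fst u) \<subseteq> S" "set (map fst v) \<subseteq> S"
      using cancel by (auto simp: signed_words_def)
    ultimately have "inversions (map fst u @ [s, s] @ map fst v) = inversions (map fst u @ map fst v)"
      using cancel s generator_square[OF cancel(1)] by (intro drop) (simp_all del: inversions.simps)
    then show ?case
      by simp
  next
    case (relator r u v)
    then obtain s t n where r: "s \<in> S" "t \<in> S" "r = concat (replicate n [(s, True), (t, True)])"
      by (auto simp: coxeter_relators_def)
    have st: "s \<in> carrier W" "t \<in> carrier W"
      using r S_closed by auto
    have r': "map fst r = concat (replicate n [s, t])"
      by (simp add: r map_concat)
    have pow: "word_prod (concat (replicate k [s, t])) = (s \<otimes> t) [^] k" for k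
    proof (induction k)
      case (Suc k)
      then show ?case
        using st nat_pow_Suc2[of "s \<otimes> t" k] by (simp add: m_assoc[symmetric])
    qed simp
    \<comment> \<open>The relation \<open>(s t)^n = 1\<close> in \<open>W\<close>, needed by
      \<open>inversions_relator\<close>, is read off from the presentation.\<close>
    have "word_value r = word_value []"
      using word_eq.relator[OF relator(1,2), of "[]" "[]"] relator(2)
      by (subst word_value_eq_iff) (auto simp: signed_words_def)
    then have prod: "word_prod (map fst r) = \<one>"
      using relator(2) by (simp add: word_value_Nil word_value_eq_word_prod)
    then have "inversions (map fst r) = {}"
      unfolding r' pow using st r generator_square by (intro inversions_relator) auto
    moreover have "set (map fst u) \<subseteq> S" "set (map fst v) \<subseteq> S" "set (map fst r) \<subseteq> S"
      using relator by (auto simp: signed_words_def)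
    ultimately show ?case
      using drop[of "map fst u" "map fst v" "map fst r"] prod by (simp only: map_append)
  }
qed auto

text \<open>Giving every letter a positive sign makes the congruence invariance applicable. The
  inversion set thereby becomes a function of the group element.\<close>

lemma inversions_eq:
  assumes "set u \<subseteq> S" "set v \<subseteq> S" "word_prod u = word_prod v"
  shows "inversions u = inversions v"
proof -
  let ?e = "map (\<lambda>s. (s, True))"
  have map_fst: "map fst (?e w) = w" for w :: "'w list"
    by (induction w) auto
  have words: "?e u \<in> signed_words S" "?e v \<in> signed_words S"
    using assms by (auto simp: signed_words_def)
  then have "word_value (?e u) = word_value (?e v)"
    using assms by (simp only: word_value_eq_word_prod map_fst)
  then show ?thesis
    using word_eq_inversions[of "?e u" "?e v"] words
    by (simp only: word_value_eq_iff map_fst)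
qed

lemma word_exists:
  assumes "g \<in> carrier W"
  shows "\<exists>w. set w \<subseteq> S \<and> word_prod w = g"
proof -
  have "h ` carrier (presented_group S (coxeter_relators S m)) = carrier W"
    using h_iso by (simp add: iso_def bij_betw_def)
  then have "g \<in> h ` (signed_words S // word_rel S (coxeter_relators S m))"
    using assms by (simp add: presented_group_def)
  then obtain u where u: "u \<in> signed_words S" "word_value u = g"
    unfolding word_value_def by (blast elim: quotientE)
  then show ?thesis
    by (intro exI[of _ "map fst u"]) (auto simp: word_value_eq_word_prod signed_words_def)
qed

text \<open>The first letter of a reduced word is an inversion of it, by the exchange condition.\<close>

lemma trivial_if_no_generator_inversion:
  assumes "set w \<subseteq> S" "inversions w \<inter> S = {}"
  shows "word_prod w = \<one>"
proof -
  \<comment> \<open>The inversion set depends only on the product, so \<open>w\<close> may be traded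
    for a shortest word.\<close>
  obtain u where u: "set u \<subseteq> S" "word_prod u = word_prod w"
    and min: "\<And>v. set v \<subseteq> S \<Longrightarrow> word_prod v = word_prod w \<Longrightarrow> length u \<le> length v"
    using ex_has_least_nat[of "\<lambda>u. set u \<subseteq> S \<and> word_prod u = word_prod w" w length] assms(1)
    by blast
  show ?thesis
  proof (cases u)
    case (Cons x v)
    have cl: "x \<in> carrier W" "set v \<subseteq> carrier W" "x \<in> S"
      using u Cons S_closed by auto
    have "x \<notin> inversions u"
      using inversions_eq[OF u(1) assms(1) u(2)] assms(2) cl by blast
    \<comment> \<open>The first letter always contributes \<open>x\<close> once; its absence from
      \<open>inversions u\<close> forces a cancelling contribution from \<open>v\<close>.\<close>
    then have "x \<in> inversions v"
      using cl Cons inv_generator generator_square by simp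
    then obtain a y b where ab: "v = a @ y # b" "x \<otimes> word_prod a = word_prod a \<otimes> y"
      using inversions_split cl by blast
    have cl': "set a \<subseteq> carrier W" "y \<in> carrier W" "set b \<subseteq> carrier W" "y \<in> S"
      using ab(1) cl(2) u Cons by auto
    have "word_prod u = (x \<otimes> word_prod a) \<otimes> (y \<otimes> word_prod b)"
      using cl cl' Cons by (simp add: ab(1) word_prod_append m_assoc)
    also have "\<dots> = word_prod a \<otimes> (y \<otimes> y) \<otimes> word_prod b"
      unfolding ab(2) using cl' by (simp add: m_assoc)
    also have "\<dots> = word_prod (a @ b)"
      using cl' generator_square by (simp add: word_prod_append)
    \<comment> \<open>Deleting \<open>x\<close> and \<open>y\<close> leaves the product unchanged
      and shortens the word by two, against minimality.\<close>
    finally have "length u \<le> length (a @ b)"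
      using u Cons ab by (intro min) auto
    with Cons ab show ?thesis
      by simp
  qed (use u in simp)
qed

theorem finite_center: "finite {z \<in> carrier W. \<forall>g\<in>carrier W. z \<otimes> g = g \<otimes> z}" (is "finite ?Z")
proof -
  have "\<forall>z\<in>carrier W. \<exists>w. set w \<subseteq> S \<and> word_prod w = z"
    using word_exists by blast
  from bchoice[OF this] obtain f
    where "\<forall>z\<in>carrier W. set (f z) \<subseteq> S \<and> word_prod (f z) = z" ..
  then have f: "\<And>z. z \<in> ?Z \<Longrightarrow> set (f z) \<subseteq> S" "\<And>z. z \<in> ?Z \<Longrightarrow> word_prod (f z) = z"
    by simp_all
  have "inj_on (\<lambda>z. inversions (f z) \<inter> S) ?Z"
  proof (rule inj_onI)
    fix y z assume yz: "y \<in> ?Z" "z \<in> ?Z" and eq: "inversions (f y) \<inter> S = inversions (f z) \<inter> S"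
    then have cl: "y \<in> carrier W" "z \<in> carrier W"
      by auto
    \<comment> \<open>Injectivity is tested on \<open>u @ f z\<close>, a word for
      \<open>inv y \<otimes> z\<close>: it will have no inversion in \<open>S\<close>.\<close>
    obtain u where u: "set u \<subseteq> S" "word_prod u = inv y"
      using word_exists cl by blast
    have central: "inv (inv y) \<otimes> r \<otimes> inv y = r" if "r \<in> carrier W" for r
      using yz that by (simp add: m_assoc)
    \<comment> \<open>Conjugation by the central element \<open>inv y\<close> is trivial, so the
      cocycle is additive here.\<close>
    have app: "r \<in> inversions (u @ f x) \<longleftrightarrow> (r \<in> inversions u) \<noteq> (r \<in> inversions (f x))"
      if "x \<in> ?Z" "r \<in> carrier W" for x r
    proof -
      have "set u \<subseteq> carrier W" "set (f x) \<subseteq> carrier W"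
        using u(1) f(1)[OF that(1)] S_closed by blast+
      from mem_inversions_append[OF this that(2)] show ?thesis
        unfolding u(2) central[OF that(2)] .
    qed
    have prod: "word_prod (u @ f x) = inv y \<otimes> x" if "x \<in> ?Z" for x
      using word_prod_append[of u "f x"] u f(1)[OF that] f(2)[OF that] S_closed by simp
    \<comment> \<open>As \<open>u @ f y\<close> represents the identity, \<open>app\<close> shows
      that \<open>u\<close> and \<open>f y\<close> have the same inversions.\<close>
    have "inversions (u @ f y) = inversions []"
      using u f(1)[OF yz(1)] cl by (intro inversions_eq) (auto simp: prod[OF yz(1)])
    then have "r \<notin> inversions (u @ f z)" if r: "r \<in> S" for r
    proof -
      have "r \<in> carrier W" "r \<in> inversions (f y) \<longleftrightarrow> r \<in> inversions (f z)"
        using r S_closed eq by blast+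
      then show ?thesis
        using app[OF yz(1), of r] app[OF yz(2), of r] \<open>inversions (u @ f y) = inversions []\<close>
        by simp
    qed
    then have "inversions (u @ f z) \<inter> S = {}"
      by blast
    then have "inv y \<otimes> z = \<one>"
      using trivial_if_no_generator_inversion[of "u @ f z"] u f(1)[OF yz(2)] prod[OF yz(2)] by simp
    then show "y = z"
      using cl by (metis inv_equality inv_inv inv_closed inv_comm)
  qed
  moreover have "finite ((\<lambda>z. inversions (f z) \<inter> S) ` ?Z)"
    by (rule finite_subset[of _ "Pow S"]) (use finite_S in auto)
  ultimately show ?thesis
    using finite_image_iff by blast
qed

end

lemma coxeter_system_finite_center:
  assumes "coxeter_system W S"
  shows "finite {z \<in> carrier W. \<forall>g\<in>carrier W. z \<otimes>\<^bsub>W\<^esub> g = g \<otimes>\<^bsub>W\<^esub> z}"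
proof -
  obtain m h where "group W" "finite S" "S \<subseteq> carrier W" "coxeter_matrix S m"
    "h \<in> iso (presented_group S (coxeter_relators S m)) W"
    "\<forall>s\<in>S. h (word_rel S (coxeter_relators S m) `` {[(s, True)]}) = s"
    using assms unfolding coxeter_system_def has_presentation_def by blast
  then interpret coxeter_group W S m h
    by (simp add: coxeter_group_def coxeter_group_axioms_def)
  show ?thesis
    by (rule finite_center)
qed

section \<open>Displacement functions in CAT(0) spaces\<close>

text \<open>The parametrization is kept, not just its image, because points at equal ratios along
  two geodesics will be compared.\<close>

definition geodesic_path :: "'x::metric_space set \<Rightarrow> 'x \<Rightarrow> 'x \<Rightarrow> (real \<Rightarrow> 'x) \<Rightarrow> bool" where
  "geodesic_path X x y c \<longleftrightarrow> c 0 = x \<and> c (dist x y) = y \<and>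
    (\<forall>s\<in>{0..dist x y}. \<forall>t\<in>{0..dist x y}. dist (c s) (c t) = \<bar>s - t\<bar>) \<and>
    c ` {0..dist x y} \<subseteq> X"

lemma geodesic_segment_iff_path:
  "geodesic_segment X x y A \<longleftrightarrow> (\<exists>c. geodesic_path X x y c \<and> A = c ` {0..dist x y})"
  unfolding geodesic_segment_def geodesic_path_def by (rule ex_cong1) blast

lemma geodesic_path_reverse:
  assumes "geodesic_path X x y c"
  shows "geodesic_path X y x (\<lambda>t. c (dist x y - t))"
proof -
  have mem: "dist x y - t \<in> {0..dist x y}" if "t \<in> {0..dist x y}" for t
    using that by simp
  then have "(\<lambda>t. c (dist x y - t)) ` {0..dist x y} \<subseteq> c ` {0..dist x y}"
    by blast
  moreover have "dist (c (dist x y - s)) (c (dist x y - t)) = \<bar>s - t\<bar>"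
    if "s \<in> {0..dist x y}" "t \<in> {0..dist x y}" for s t
    using assms mem[OF that(1)] mem[OF that(2)] unfolding geodesic_path_def by simp
  ultimately show ?thesis
    using assms unfolding geodesic_path_def dist_commute[of y x] by (simp add: subset_trans)
qed

lemma geodesic_path_isometry:
  assumes "geodesic_path X x y c" "x \<in> X" "y \<in> X" "f ` X \<subseteq> X"
    "\<And>x y. x \<in> X \<Longrightarrow> y \<in> X \<Longrightarrow> dist (f x) (f y) = dist x y"
  shows "geodesic_path X (f x) (f y) (f \<circ> c)"
  using assms(1,4) unfolding geodesic_path_def assms(5)[OF assms(2,3)]
  by (simp add: image_subset_iff assms(5))

lemma norm_real2: "norm (v :: real^2) = sqrt ((v $ 1)\<^sup>2 + (v $ 2)\<^sup>2)"
  by (simp add: norm_vec_def L2_set_def sum_2)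

text \<open>Put \<open>p\<close> at the origin and \<open>q\<close> on the first axis; the law of
  cosines gives the first coordinate of \<open>r\<close>. The case \<open>a = 0\<close>, where that
  formula would divide by zero, is a degenerate triangle.\<close>

lemma comparison_triangle_exists:
  fixes a b c :: real
  assumes "0 \<le> a" "0 \<le> c" "a \<le> b + c" "b \<le> a + c" "c \<le> a + b"
  obtains p q r :: "real^2" where "dist p q = a" "dist q r = b" "dist r p = c"
proof (cases "a = 0")
  case True
  have "dist (vector [c, 0] :: real^2) 0 = c"
    using assms by (simp add: dist_norm norm_real2)
  moreover have "b = c"
    using True assms by simp
  ultimately show ?thesis
    using that[of 0 0 "vector [c, 0]"] True by (simp add: dist_commute)
next
  case False
  then have a: "a > 0" using assms by simp
  define x where "x = (c\<^sup>2 + a\<^sup>2 - b\<^sup>2) / (2 * a)"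
  define y where "y = sqrt (c\<^sup>2 - x\<^sup>2)"
  have xa: "2 * a * x = c\<^sup>2 + a\<^sup>2 - b\<^sup>2"
    using a by (simp add: x_def)
  \<comment> \<open>The squared triangle inequalities bound \<open>x\<close> between
    \<open>- c\<close> and \<open>c\<close>, so the square root defining \<open>y\<close> has a
    nonnegative argument.\<close>
  have "b\<^sup>2 \<le> (a + c)\<^sup>2" "(a - c)\<^sup>2 \<le> b\<^sup>2"
    using assms by (auto intro!: power_mono simp: abs_le_square_iff[symmetric])
  then have ineqs: "2 * a * x \<le> 2 * a * c" "2 * a * (- c) \<le> 2 * a * x"
    unfolding xa by (auto simp: power2_sum power2_diff)
  have "x \<le> c" "- c \<le> x"
    by (rule mult_left_le_imp_le[OF ineqs(1)] mult_left_le_imp_le[OF ineqs(2)]; use a in simp)+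
  then have "\<bar>x\<bar> \<le> \<bar>c\<bar>"
    by simp
  then have y: "y\<^sup>2 = c\<^sup>2 - x\<^sup>2"
    by (simp add: y_def abs_le_square_iff)
  have b: "0 \<le> b" using assms by linarith
  let ?p = "0 :: real^2" and ?q = "vector [a, 0] :: real^2" and ?r = "vector [x, y] :: real^2"
  have "dist ?p ?q = a"
    using a by (simp add: dist_norm norm_real2)
  moreover have "(a - x)\<^sup>2 + y\<^sup>2 = b\<^sup>2"
    using y xa by (simp add: power2_diff algebra_simps)
  then have "dist ?q ?r = b"
    using b by (simp add: dist_norm norm_real2)
  moreover have "dist ?r ?p = c"
    using assms y by (simp add: dist_norm norm_real2)
  ultimately show ?thesis
    using that by blast
qed

text \<open>In the comparison triangle the points at ratio \<open>l\<close> on the two sides from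
  \<open>p'\<close> span a similar triangle, so their distance is exactly \<open>l\<close> times the
  opposite side.\<close>

lemma CAT0_paths_from_point:
  assumes "CAT0 X" "geodesic_path X p q c" "geodesic_path X p r e"
    and "q \<in> X" "r \<in> X" "0 \<le> l" "l \<le> 1"
  shows "dist (c (l * dist p q)) (e (l * dist p r)) \<le> l * dist q r"
proof -
  have "geodesic_space X"
    using assms(1) by (simp only: CAT0_def)
  then obtain B where B: "geodesic_segment X q r B"
    using assms(4,5) unfolding geodesic_space_def by blast
  define A where "A = c ` {0..dist p q}"
  \<comment> \<open>The third side of a triangle runs from \<open>r\<close> to \<open>p\<close>,
    hence the reversed parametrization.\<close>
  define C where "C = (\<lambda>t. e (dist p r - t)) ` {0..dist r p}"
  have A: "geodesic_segment X p q A"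
    using assms(2) unfolding geodesic_segment_iff_path A_def by blast
  have C: "geodesic_segment X r p C"
    using geodesic_path_reverse[OF assms(3)] unfolding geodesic_segment_iff_path C_def by blast
  obtain p' q' r' :: "real^2" where tri:
    "dist p' q' = dist p q" "dist q' r' = dist q r" "dist r' p' = dist r p"
    by (rule comparison_triangle_exists[of "dist p q" "dist r p" "dist q r"])
      (use dist_triangle[of p q r] dist_triangle[of q r p] dist_triangle[of r p q]
        in \<open>auto simp: dist_commute\<close>)
  let ?x = "c (l * dist p q)" and ?y = "e (l * dist p r)"
  let ?x' = "p' + l *\<^sub>R (q' - p')" and ?y' = "p' + l *\<^sub>R (r' - p')"
  have l: "0 \<le> l * d \<and> l * d \<le> d" if "0 \<le> d" for d :: real
    using assms that mult_left_le_one_le by simp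
  have x: "comparison_point p A p' q' ?x ?x'"
    unfolding comparison_point_def
  proof (intro conjI)
    show "?x \<in> A"
      using l[of "dist p q"] by (auto simp: A_def)
    show "?x' \<in> closed_segment p' q'"
      unfolding in_segment using assms by (intro exI[of _ l]) (simp add: algebra_simps)
    have "dist p ?x = l * dist p q"
      using assms(2) l[of "dist p q"] unfolding geodesic_path_def
      by (metis abs_of_nonneg atLeastAtMost_iff diff_0_right dist_commute order_refl zero_le_dist)
    moreover have "dist p' ?x' = l * dist p' q'"
      using assms by (simp add: dist_norm norm_minus_commute)
    ultimately show "dist p' ?x' = dist p ?x"
      using tri by simp
  qed
  have y: "comparison_point r C r' p' ?y ?y'"
    unfolding comparison_point_def
  proof (intro conjI)
    have "dist p r - l * dist p r \<in> {0..dist r p}"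
      using l[of "dist p r"] by (simp add: dist_commute)
    then show "?y \<in> C"
      unfolding C_def by (intro image_eqI[where x = "dist p r - l * dist p r"]) simp_all
    show "?y' \<in> closed_segment r' p'"
      unfolding in_segment using assms by (intro exI[of _ "1 - l"]) (simp add: algebra_simps)
    have "dist r ?y = dist p r - l * dist p r"
      using assms(3) l[of "dist p r"] unfolding geodesic_path_def
      by (metis abs_of_nonneg atLeastAtMost_iff diff_ge_0_iff_ge order_refl zero_le_dist)
    moreover have "r' - ?y' = (1 - l) *\<^sub>R (r' - p')"
      by (simp add: algebra_simps)
    then have "dist r' ?y' = (1 - l) * dist r' p'"
      using assms by (simp add: dist_norm)
    ultimately show "dist r' ?y' = dist r ?y"
      using tri by (simp add: dist_commute algebra_simps)
  qed
  have "dist ?x ?y \<le> dist ?x' ?y'"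
    using assms(1)[unfolded CAT0_def Let_def, THEN conjunct2, rule_format, OF A B C tri
        disjI1[OF x] disjI2[OF disjI2[OF y]]] .
  also have "?x' - ?y' = l *\<^sub>R (q' - r')"
    by (simp add: algebra_simps)
  then have "dist ?x' ?y' = l * dist q r"
    using assms tri by (simp add: dist_norm)
  finally show ?thesis .
qed

text \<open>A diagonal geodesic from \<open>x\<close> to \<open>f y\<close> cuts the quadrilateral
  \<open>x, y, f y, f x\<close> into two triangles. Comparing \<open>z\<close> and
  \<open>f z\<close> with the matching point of the diagonal bounds the displacement of
  \<open>z\<close> by the convex combination of those at the ends.\<close>

lemma CAT0_displacement_convex:
  assumes "CAT0 X" "f ` X \<subseteq> X" "\<And>x y. x \<in> X \<Longrightarrow> y \<in> X \<Longrightarrow> dist (f x) (f y) = dist x y"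
  shows "geodesically_convex X {x \<in> X. dist x (f x) \<le> C}"
  unfolding geodesically_convex_def
proof (intro conjI ballI allI impI subsetI)
  fix x y A z
  assume xy: "x \<in> {x \<in> X. dist x (f x) \<le> C}" "y \<in> {x \<in> X. dist x (f x) \<le> C}"
    and A: "geodesic_segment X x y A" and z: "z \<in> A"
  from A obtain c where c: "geodesic_path X x y c" "A = c ` {0..dist x y}"
    by (auto simp: geodesic_segment_iff_path)
  with z obtain t where t: "0 \<le> t" "t \<le> dist x y" "z = c t"
    by auto
  \<comment> \<open>If \<open>x = y\<close>, division by zero gives \<open>l = 0\<close>, which is
    consistent because then \<open>t = 0\<close>.\<close>
  define l where "l = t / dist x y"
  have l: "0 \<le> l" "l \<le> 1" "t = l * dist x y"
    using t by (auto simp: l_def divide_simps)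
  have zX: "z \<in> X"
    using A z by (auto simp: geodesic_segment_def)
  have fX: "x \<in> X" "y \<in> X" "f x \<in> X" "f y \<in> X"
    using xy assms by auto
  have dfxy: "dist (f x) (f y) = dist x y"
    using assms fX by simp
  have "geodesic_space X"
    using assms(1) by (simp only: CAT0_def)
  then obtain e where e: "geodesic_path X x (f y) e"
    using fX unfolding geodesic_space_def geodesic_segment_iff_path by blast
  have fc: "geodesic_path X (f x) (f y) (f \<circ> c)"
    by (intro geodesic_path_isometry) (use c fX assms in auto)
  let ?w = "e (l * dist x (f y))"
  have "dist z ?w \<le> l * dist y (f y)"
    using CAT0_paths_from_point[OF assms(1) c(1) e fX(2,4)] l t by simp
  \<comment> \<open>The second triangle is viewed from \<open>f y\<close>, so both paths are
    reversed and the ratio is \<open>1 - l\<close>.\<close>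
  moreover have "dist ?w (f z) \<le> (1 - l) * dist x (f x)"
    using CAT0_paths_from_point[OF assms(1) geodesic_path_reverse[OF e] geodesic_path_reverse[OF fc]
        fX(1,3), of "1 - l"] l t
    by (simp add: dist_commute[of "f y"] dfxy algebra_simps)
  ultimately have "dist z (f z) \<le> l * dist y (f y) + (1 - l) * dist x (f x)"
    using dist_triangle[of z "f z" ?w] by linarith
  also have "\<dots> \<le> l * C + (1 - l) * C"
    using xy l by (intro add_mono mult_left_mono) auto
  finally show "z \<in> {x \<in> X. dist x (f x) \<le> C}"
    using zX by (simp add: algebra_simps)
qed auto

text \<open>Keeping \<open>X\<close> in the intersection makes the empty family yield
  \<open>X\<close>; this occurs when the generating set of a factor is empty.\<close>

lemma geodesically_convex_Inter:
  assumes "\<And>i. i \<in> I \<Longrightarrow> geodesically_convex X (Y i)"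
  shows "geodesically_convex X {x \<in> X. \<forall>i\<in>I. x \<in> Y i}"
  unfolding geodesically_convex_def
proof (intro conjI ballI allI impI subsetI)
  fix x y A z
  assume "x \<in> {x \<in> X. \<forall>i\<in>I. x \<in> Y i}" "y \<in> {x \<in> X. \<forall>i\<in>I. x \<in> Y i}"
    and A: "geodesic_segment X x y A" and z: "z \<in> A"
  then have "z \<in> Y i" if "i \<in> I" for i
    using assms[OF that] that unfolding geodesically_convex_def by blast
  moreover have "z \<in> X"
    using A z by (auto simp: geodesic_segment_def)
  ultimately show "z \<in> {x \<in> X. \<forall>i\<in>I. x \<in> Y i}"
    by blast
qed auto

section \<open>Geometric actions\<close>

locale geometric_action = group_action G X \<phi>
  for G :: "('g, 'b) monoid_scheme" (structure) and X :: "'x::metric_space set" and \<phi> +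
  assumes geometric: "acts_geometrically G X \<phi>"
begin

sublocale group G
  using group_hom by (rule group_hom.axioms(1))

lemma dist_action:
  "g \<in> carrier G \<Longrightarrow> x \<in> X \<Longrightarrow> y \<in> X \<Longrightarrow> dist (\<phi> g x) (\<phi> g y) = dist x y"
  using geometric by (simp add: acts_geometrically_def)

lemma action_closed: "g \<in> carrier G \<Longrightarrow> x \<in> X \<Longrightarrow> \<phi> g x \<in> X"
  using element_image by blast

lemma action_inv: "g \<in> carrier G \<Longrightarrow> x \<in> X \<Longrightarrow> \<phi> (inv g) (\<phi> g x) = x"
  using orbit_sym_aux by blast

lemma continuous_on_action:
  assumes "g \<in> carrier G" "A \<subseteq> X"
  shows "continuous_on A (\<phi> g)"
  unfolding continuous_on_iff
proof (intro ballI allI impI)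
  fix x and e :: real assume "x \<in> A" "e > 0"
  with assms show "\<exists>d>0. \<forall>y\<in>A. dist y x < d \<longrightarrow> dist (\<phi> g y) (\<phi> g x) < e"
    by (intro exI[of _ e]) (auto simp: dist_action subset_iff)
qed

text \<open>Proper discontinuity concerns a ball around each single point. Compactness makes the
  radius uniform, and finite nets extend finiteness from returns near one point to transports
  between any two points of \<open>K\<close>.\<close>

lemma proper_on_compact:
  assumes K: "compact K" "K \<subseteq> X"
  obtains \<delta> where "\<delta> > 0" "finite {g \<in> carrier G. \<exists>k\<in>K. \<exists>k'\<in>K. dist k (\<phi> g k') < \<delta>}"
proof -
  have "\<forall>x\<in>K. \<exists>r>0. finite {g \<in> carrier G. \<phi> g ` (X \<inter> ball x r) \<inter> (X \<inter> ball x r) \<noteq> {}}"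
    using geometric K unfolding acts_geometrically_def properly_discontinuous_def by blast
  from bchoice[OF this] obtain r where r: "\<And>x. x \<in> K \<Longrightarrow> r x > 0"
    "\<And>x. x \<in> K \<Longrightarrow>
      finite {g \<in> carrier G. \<phi> g ` (X \<inter> ball x (r x)) \<inter> (X \<inter> ball x (r x)) \<noteq> {}}"
    by blast
  \<comment> \<open>A Lebesgue number of the cover by the given balls.\<close>
  obtain \<epsilon> where \<epsilon>: "\<epsilon> > 0" "\<And>x. x \<in> K \<Longrightarrow> \<exists>B\<in>(\<lambda>x. ball x (r x)) ` K. ball x \<epsilon> \<subseteq> B"
  proof (rule Heine_Borel_lemma[OF K(1)])
    show "K \<subseteq> \<Union> ((\<lambda>x. ball x (r x)) ` K)"
      using r(1) by fastforce
  qed auto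
  have return: "finite {g \<in> carrier G. \<exists>y\<in>X. dist x y < \<epsilon> \<and> dist x (\<phi> g y) < \<epsilon>}" (is "finite ?A")
    if x: "x \<in> K" for x
  proof -
    obtain x' where x': "x' \<in> K" "ball x \<epsilon> \<subseteq> ball x' (r x')"
      using \<epsilon>(2)[OF x] by blast
    have "?A \<subseteq> {g \<in> carrier G. \<phi> g ` (X \<inter> ball x' (r x')) \<inter> (X \<inter> ball x' (r x')) \<noteq> {}}"
    proof safe
      fix g y assume g: "g \<in> carrier G" "y \<in> X" "dist x y < \<epsilon>" "dist x (\<phi> g y) < \<epsilon>"
        and empty: "\<phi> g ` (X \<inter> ball x' (r x')) \<inter> (X \<inter> ball x' (r x')) = {}"
      have "y \<in> X \<inter> ball x' (r x')" "\<phi> g y \<in> X \<inter> ball x' (r x')"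
        using g x'(2) action_closed by (auto simp: subset_iff)
      with empty show False
        by blast
    qed
    then show ?thesis
      using r(2)[OF x'(1)] finite_subset by blast
  qed
  \<comment> \<open>For a fixed \<open>g0\<close> in the set, \<open>g \<otimes> inv g0\<close>
    moves \<open>\<phi> g0 y\<close> to \<open>\<phi> g y\<close>, both near \<open>x\<close>, which
    reduces the claim to \<open>return\<close>.\<close>
  have transport: "finite {g \<in> carrier G. dist x (\<phi> g y) < \<epsilon>}" (is "finite ?A")
    if x: "x \<in> K" and y: "y \<in> X" for x y
  proof (cases "?A = {}")
    case False
    then obtain g0 where g0: "g0 \<in> carrier G" "dist x (\<phi> g0 y) < \<epsilon>"
      by blast
    have "(\<lambda>g. g \<otimes> inv g0) ` ?A \<subseteq>
        {g \<in> carrier G. \<exists>y\<in>X. dist x y < \<epsilon> \<and> dist x (\<phi> g y) < \<epsilon>}"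
    proof safe
      fix g assume g: "g \<in> carrier G" "dist x (\<phi> g y) < \<epsilon>"
      have "\<phi> (g \<otimes> inv g0) (\<phi> g0 y) = \<phi> g y"
        using g g0 y by (simp add: composition_rule action_closed action_inv)
      then show "\<exists>y\<in>X. dist x y < \<epsilon> \<and> dist x (\<phi> (g \<otimes> inv g0) y) < \<epsilon>"
        using g g0 y action_closed by (intro bexI[of _ "\<phi> g0 y"]) auto
    qed (use g0 in auto)
    moreover have "inj_on (\<lambda>g. g \<otimes> inv g0) ?A"
      using g0 by (auto intro!: inj_onI)
    ultimately show ?thesis
      using return[OF x] finite_subset finite_imageD by blast
  qed (use finite.emptyI in metis)
  \<comment> \<open>With radius \<open>\<epsilon> / 3\<close>, replacing both \<open>k\<close> and
    \<open>k'\<close> by net points still leaves a total distance below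
    \<open>\<epsilon>\<close>.\<close>
  have "K \<subseteq> (\<Union>x\<in>K. ball x (\<epsilon> / 3))"
    using \<epsilon>(1) by force
  then obtain C where C: "C \<subseteq> K" "finite C" "K \<subseteq> (\<Union>x\<in>C. ball x (\<epsilon> / 3))"
    using compactE_image[OF K(1), of K "\<lambda>x. ball x (\<epsilon> / 3)"] by auto
  have "{g \<in> carrier G. \<exists>k\<in>K. \<exists>k'\<in>K. dist k (\<phi> g k') < \<epsilon> / 3} \<subseteq>
      (\<Union>x\<in>C. \<Union>y\<in>C. {g \<in> carrier G. dist x (\<phi> g y) < \<epsilon>})"
  proof safe
    fix g k k' assume g: "g \<in> carrier G" "k \<in> K" "k' \<in> K" "dist k (\<phi> g k') < \<epsilon> / 3"
    have "k \<in> (\<Union>x\<in>C. ball x (\<epsilon> / 3))" "k' \<in> (\<Union>x\<in>C. ball x (\<epsilon> / 3))"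
      using C(3) g by blast+
    then obtain x y where xy: "x \<in> C" "dist x k < \<epsilon> / 3" "y \<in> C" "dist y k' < \<epsilon> / 3"
      by auto
    have "y \<in> X" "k' \<in> X"
      using xy g C K by blast+
    then have "dist (\<phi> g k') (\<phi> g y) < \<epsilon> / 3"
      using xy g dist_action[of g k' y] by (simp add: dist_commute)
    then have "dist x (\<phi> g y) < \<epsilon>"
      using xy g dist_triangle[of x "\<phi> g y" k] dist_triangle[of k "\<phi> g y" "\<phi> g k'"] by linarith
    with xy g show "g \<in> (\<Union>x\<in>C. \<Union>y\<in>C. {g \<in> carrier G. dist x (\<phi> g y) < \<epsilon>})"
      by blast
  qed
  moreover have "finite (\<Union>x\<in>C. \<Union>y\<in>C. {g \<in> carrier G. dist x (\<phi> g y) < \<epsilon>})"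
    using C K by (intro finite_UN_I transport) auto
  ultimately have "finite {g \<in> carrier G. \<exists>k\<in>K. \<exists>k'\<in>K. dist k (\<phi> g k') < \<epsilon> / 3}"
    by (rule finite_subset)
  moreover have "\<epsilon> / 3 > 0"
    using \<epsilon>(1) by simp
  ultimately show ?thesis
    by (intro that)
qed

text \<open>
  A geodesic of length \<open>< n\<delta>\<close> is cut into \<open>n\<close> pieces, whose ends are moved into \<open>K\<close>; so
  the bounded displacement set is a product of \<open>n\<close> copies of the finite set for \<open>\<delta>\<close>.
\<close>

lemma finite_bounded_displacement:
  assumes K: "compact K" "K \<subseteq> X" and cover: "(\<Union>g\<in>carrier G. \<phi> g ` K) = X"
    and geo: "geodesic_space X"
  shows "finite {g \<in> carrier G. \<exists>k\<in>K. \<exists>k'\<in>K. dist k (\<phi> g k') \<le> R}"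
proof -
  define F where "F r = {g \<in> carrier G. \<exists>k\<in>K. \<exists>k'\<in>K. dist k (\<phi> g k') < r}" for r :: real
  obtain \<delta> where \<delta>: "\<delta> > 0" "finite (F \<delta>)"
    using proper_on_compact[OF K] unfolding F_def by blast
  \<comment> \<open>The shift to \<open>Suc n\<close> makes \<open>F \<delta>\<close> itself the
    base case.\<close>
  have fin: "finite (F (real (Suc n) * \<delta>))" for n
  proof (induction n)
    case (Suc n)
    have "F (real (Suc (Suc n)) * \<delta>) \<subseteq> (\<lambda>(a, b). a \<otimes> b) ` (F (real (Suc n) * \<delta>) \<times> F \<delta>)"
    proof
      fix g assume "g \<in> F (real (Suc (Suc n)) * \<delta>)"
      then obtain k k' where g: "g \<in> carrier G" "k \<in> K" "k' \<in> K"
        "dist k (\<phi> g k') < real (Suc (Suc n)) * \<delta>"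
        unfolding F_def by blast
      define y where "y = \<phi> g k'"
      have X: "k \<in> X" "k' \<in> X" "y \<in> X"
        using g K action_closed by (auto simp: y_def)
      obtain c where c: "geodesic_path X k y c"
        using geo X unfolding geodesic_space_def geodesic_segment_iff_path by blast
      \<comment> \<open>Cutting here leaves a last piece of length
        \<open>dist k y / real (Suc (Suc n))\<close>, below \<open>\<delta>\<close>, while the first
        piece falls under the induction hypothesis.\<close>
      define t where "t = dist k y * real (Suc n) / real (Suc (Suc n))"
      have t0: "0 \<le> t"
        by (simp add: t_def)
      have t1: "dist k y - t = dist k y / real (Suc (Suc n))"
        by (simp add: t_def field_simps)
      then have t2: "t \<le> dist k y"
        by (smt (verit) divide_nonneg_nonneg of_nat_0_le_iff zero_le_dist)
      have ky: "dist k y / real (Suc (Suc n)) < \<delta>"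
        using g(4) unfolding y_def by (simp add: divide_less_eq mult.commute)
      have "t = real (Suc n) * (dist k y / real (Suc (Suc n)))"
        by (simp add: t_def)
      also have "\<dots> < real (Suc n) * \<delta>"
        using ky by (intro mult_strict_left_mono) auto
      finally have t3: "t < real (Suc n) * \<delta>" .
      have mem: "0 \<in> {0..dist k y}" "t \<in> {0..dist k y}" "dist k y \<in> {0..dist k y}"
        using t0 t2 by auto
      have c_ends: "c 0 = k" "c (dist k y) = y" and ct: "c t \<in> X"
        using c mem(2) unfolding geodesic_path_def by blast+
      have isom: "dist (c a) (c b) = \<bar>a - b\<bar>"
        if "a \<in> {0..dist k y}" "b \<in> {0..dist k y}" for a b
        using c that unfolding geodesic_path_def by blast
      have kt: "dist k (c t) = t"
        using isom[OF mem(1,2)] c_ends t0 by simp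
      have ty: "dist (c t) y = dist k y - t"
        using isom[OF mem(2,3)] c_ends t2 by simp
      from ct obtain h k'' where h: "h \<in> carrier G" "k'' \<in> K" "c t = \<phi> h k''"
        using cover by blast
      have "k'' \<in> X"
        using h K by blast
      have "h \<in> F (real (Suc n) * \<delta>)"
        using h g kt t3 unfolding F_def by auto
      moreover have "\<phi> h (\<phi> (inv h \<otimes> g) k') = y"
        using h g X by (simp add: y_def composition_rule[symmetric] m_assoc[symmetric])
      then have "dist k'' (\<phi> (inv h \<otimes> g) k') = dist (c t) y"
        using dist_action[of h k'' "\<phi> (inv h \<otimes> g) k'"] h g X \<open>k'' \<in> X\<close> action_closed by simp
      then have "dist k'' (\<phi> (inv h \<otimes> g) k') < \<delta>"
        using ty t1 ky by simp
      then have "inv h \<otimes> g \<in> F \<delta>"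
        unfolding F_def using h g by (intro CollectI conjI bexI[of _ k''] bexI[of _ k']) simp_all
      moreover have "g = h \<otimes> (inv h \<otimes> g)"
        using h g by (simp add: m_assoc[symmetric])
      ultimately show "g \<in> (\<lambda>(a, b). a \<otimes> b) ` (F (real (Suc n) * \<delta>) \<times> F \<delta>)"
        by force
    qed
    then show ?case
      using Suc \<delta>(2) finite_subset by blast
  qed (use \<delta> in simp)
  obtain n where "R / \<delta> < real n"
    using reals_Archimedean2 by blast
  then have "R < real (Suc n) * \<delta>"
    using \<delta>(1) by (simp add: divide_less_eq distrib_right)
  then have "{g \<in> carrier G. \<exists>k\<in>K. \<exists>k'\<in>K. dist k (\<phi> g k') \<le> R} \<subseteq> F (real (Suc n) * \<delta>)"
    unfolding F_def by (auto intro: le_less_trans)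
  then show ?thesis
    using fin finite_subset by blast
qed

section \<open>Cocompactness of centralizers on sets of bounded displacement\<close>

lemma centralizer_cofinite_on_sublevel:
  assumes "CAT0 X" and T: "finite T" "T \<subseteq> carrier G"
    and K: "compact K" "K \<subseteq> X" and cover: "(\<Union>g\<in>carrier G. \<phi> g ` K) = X"
  shows "\<exists>D. finite D \<and> D \<subseteq> carrier G \<and> (\<forall>x\<in>X. (\<forall>s\<in>T. dist x (\<phi> s x) \<le> R) \<longrightarrow>
    (\<exists>z\<in>carrier G. (\<forall>s\<in>T. z \<otimes> s = s \<otimes> z) \<and> (\<exists>d\<in>D. \<exists>k\<in>K. x = \<phi> z (\<phi> d k))))"
proof -
  define F where "F = {g \<in> carrier G. \<exists>k\<in>K. \<exists>k'\<in>K. dist k (\<phi> g k') \<le> R}"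
  have "geodesic_space X"
    using assms(1) by (simp only: CAT0_def)
  then have F: "finite F"
    unfolding F_def by (rule finite_bounded_displacement[OF K cover])
  \<comment> \<open>Restriction to \<open>T\<close> places the tuple of conjugates in an extensional
    function space, which is finite for finite \<open>T\<close> and \<open>F\<close>.\<close>
  define \<tau> where "\<tau> g = restrict (\<lambda>s. inv g \<otimes> s \<otimes> g) T" for g
  define P where "P = {g \<in> carrier G. \<forall>s\<in>T. inv g \<otimes> s \<otimes> g \<in> F}"
  have "\<tau> ` P \<subseteq> T \<rightarrow>\<^sub>E F"
    by (auto simp: P_def \<tau>_def)
  then have "finite (\<tau> ` P)"
    by (rule finite_subset) (intro finite_PiE T F)
  \<comment> \<open>\<open>D\<close> contains a representative for each tuple that occurs.\<close>
  from finite_subset_image[OF this subset_refl]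
  obtain D where D: "D \<subseteq> P" "finite D" "\<tau> ` P = \<tau> ` D"
    by blast
  show ?thesis
  proof (intro exI conjI ballI impI)
    show "D \<subseteq> carrier G"
      using D by (auto simp: P_def)
    fix x assume x: "x \<in> X" "\<forall>s\<in>T. dist x (\<phi> s x) \<le> R"
    then obtain g k where g: "g \<in> carrier G" "k \<in> K" "x = \<phi> g k"
      using cover by blast
    have k: "k \<in> X"
      using g K by blast
    have "inv g \<otimes> s \<otimes> g \<in> F" if s: "s \<in> T" for s
    proof -
      have sG: "s \<in> carrier G"
        using s T by blast
      have "\<phi> g (\<phi> (inv g \<otimes> s \<otimes> g) k) = \<phi> s x"
        using sG g k by (simp add: composition_rule[symmetric] m_assoc[symmetric])
      then have "dist k (\<phi> (inv g \<otimes> s \<otimes> g) k) = dist x (\<phi> s x)"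
        using dist_action[of g k "\<phi> (inv g \<otimes> s \<otimes> g) k"] sG g k action_closed by simp
      also have "\<dots> \<le> R"
        using x(2) s by blast
      finally show ?thesis
        unfolding F_def using sG g by (intro CollectI conjI bexI[of _ k]) simp_all
    qed
    then have "g \<in> P"
      using g by (simp add: P_def)
    then obtain d where d: "d \<in> D" "\<tau> g = \<tau> d"
      using D(3) by blast
    then have dG: "d \<in> carrier G"
      using D(1) by (auto simp: P_def)
    \<comment> \<open>Equal tuples mean that \<open>g\<close> and \<open>d\<close> conjugate
      \<open>T\<close> in the same way, so their quotient centralizes \<open>T\<close>.\<close>
    have "g \<otimes> inv d \<otimes> s = s \<otimes> (g \<otimes> inv d)" if s: "s \<in> T" for s
    proof -
      have sG: "s \<in> carrier G"
        using s T by blast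
      have eq: "inv g \<otimes> s \<otimes> g = inv d \<otimes> s \<otimes> d"
        using fun_cong[OF d(2), of s] s by (simp add: \<tau>_def)
      have "g \<otimes> inv d \<otimes> s = g \<otimes> (inv d \<otimes> s \<otimes> d) \<otimes> inv d"
        using g dG sG by (simp add: m_assoc)
      also have "\<dots> = s \<otimes> (g \<otimes> inv d)"
        unfolding eq[symmetric] using g dG sG by (simp add: m_assoc[symmetric])
      finally show ?thesis .
    qed
    moreover have "\<phi> (g \<otimes> inv d) (\<phi> d k) = x"
      using g dG k by (simp add: composition_rule action_closed action_inv)
    ultimately show "\<exists>z\<in>carrier G. (\<forall>s\<in>T. z \<otimes> s = s \<otimes> z) \<and> (\<exists>d\<in>D. \<exists>k\<in>K. x = \<phi> z (\<phi> d k))"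
      using g dG d(1)
      by (intro bexI[of _ "g \<otimes> inv d"] conjI bexI[of _ d] bexI[of _ k]) auto
  qed (rule D)
qed

text \<open>The conditions on \<open>H\<close> and \<open>E\<close> make \<open>H\<close> a
  finite-index subgroup of the centralizer of \<open>T\<close>, so cocompactness on the sublevel set
  \<open>Y\<close> passes from the centralizer to \<open>H\<close>.\<close>

theorem cofinite_in_centralizer_convex_cocompact:
  assumes CAT0: "CAT0 X" and T: "finite T" "T \<subseteq> carrier G"
    and H: "subgroup H G" "\<And>h s. h \<in> H \<Longrightarrow> s \<in> T \<Longrightarrow> h \<otimes> s = s \<otimes> h"
    and E: "finite E" "E \<subseteq> carrier G"
      "\<And>z. z \<in> carrier G \<Longrightarrow> \<forall>s\<in>T. z \<otimes> s = s \<otimes> z \<Longrightarrow> \<exists>h\<in>H. \<exists>e\<in>E. z = h \<otimes> e"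
  shows "convex_cocompact G X \<phi> H"
proof -
  obtain K where K: "compact K" "K \<subseteq> X" "(\<Union>g\<in>carrier G. \<phi> g ` K) = X"
    using geometric unfolding acts_geometrically_def cocompact_on_def by blast
  obtain x0 where x0: "x0 \<in> X"
    using geometric unfolding acts_geometrically_def by blast
  \<comment> \<open>The sum bounds each displacement at \<open>x0\<close>, so \<open>Y\<close> is
    nonempty; unlike a maximum, it also makes sense for empty \<open>T\<close>.\<close>
  define R where "R = (\<Sum>s\<in>T. dist x0 (\<phi> s x0))"
  define Y where "Y = {x \<in> X. \<forall>s\<in>T. dist x (\<phi> s x) \<le> R}"
  obtain D where D: "finite D" "D \<subseteq> carrier G"
    "\<forall>x\<in>X. (\<forall>s\<in>T. dist x (\<phi> s x) \<le> R) \<longrightarrow>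
      (\<exists>z\<in>carrier G. (\<forall>s\<in>T. z \<otimes> s = s \<otimes> z) \<and> (\<exists>d\<in>D. \<exists>k\<in>K. x = \<phi> z (\<phi> d k)))"
    using centralizer_cofinite_on_sublevel[OF CAT0 T K, of R] by (elim exE conjE)
  have HG: "h \<in> carrier G" if "h \<in> H" for h
    using subgroup.mem_carrier[OF H(1) that] .
  have "x0 \<in> Y"
    using x0 T(1) by (auto simp: Y_def R_def intro!: member_le_sum)
  have convex: "geodesically_convex X Y"
  proof -
    have "geodesically_convex X {x \<in> X. \<forall>s\<in>T. x \<in> {x \<in> X. dist x (\<phi> s x) \<le> R}}"
      using T by (intro geodesically_convex_Inter CAT0_displacement_convex CAT0)
        (auto simp: action_closed dist_action)
    moreover have "Y = {x \<in> X. \<forall>s\<in>T. x \<in> {x \<in> X. dist x (\<phi> s x) \<le> R}}"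
      by (auto simp: Y_def)
    ultimately show ?thesis
      by simp
  qed
  have closed: "closedin (top_of_set X) Y"
  proof -
    have "closedin (top_of_set X) (X \<inter> (\<lambda>x. dist x (\<phi> s x)) -` {..R})" if "s \<in> T" for s
      using that T
      by (intro continuous_closedin_preimage closed_atMost continuous_intros continuous_on_action) auto
    \<comment> \<open>Inserting \<open>X\<close> keeps the intersected family nonempty when
      \<open>T\<close> is empty.\<close>
    then have "closedin (top_of_set X)
        (\<Inter> (insert X ((\<lambda>s. X \<inter> (\<lambda>x. dist x (\<phi> s x)) -` {..R}) ` T)))"
      by (intro closedin_Inter) auto
    moreover have "Y = \<Inter> (insert X ((\<lambda>s. X \<inter> (\<lambda>x. dist x (\<phi> s x)) -` {..R}) ` T))"
      by (auto simp: Y_def)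
    ultimately show ?thesis
      by simp
  qed
  have invariant: "\<phi> h x \<in> Y" if h: "h \<in> H" and x: "x \<in> Y" for h x
  proof -
    have "dist (\<phi> h x) (\<phi> s (\<phi> h x)) = dist x (\<phi> s x)" if s: "s \<in> T" for s
    proof -
      have "\<phi> s (\<phi> h x) = \<phi> h (\<phi> s x)"
        using x HG[OF h] s T H(2)[OF h s] by (auto simp: Y_def composition_rule[symmetric])
      then show ?thesis
        using x HG[OF h] s T by (auto simp: Y_def dist_action action_closed)
    qed
    then show ?thesis
      using x HG[OF h] by (simp add: Y_def action_closed)
  qed
  have invariant_inv: "\<phi> (inv h) x \<in> Y" "\<phi> h (\<phi> (inv h) x) = x" if "h \<in> H" "x \<in> Y" for h x
    using invariant[OF subgroup.m_inv_closed[OF H(1) that(1)] that(2)]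
      action_inv[of "inv h" x] HG[OF that(1)] that(2)
    by (auto simp: Y_def)
  \<comment> \<open>Writing the centralizing element as \<open>h \<otimes> e\<close>, each point of
    \<open>Y\<close> is an \<open>H\<close>-translate of a point in these finitely many translates
    of \<open>K\<close>. They may leave \<open>Y\<close>, hence the intersection.\<close>
  define C where "C = (\<Union>e\<in>E. \<Union>d\<in>D. \<phi> (e \<otimes> d) ` K) \<inter> Y"
  have "compact C"
  proof -
    have "compact (\<Union>e\<in>E. \<Union>d\<in>D. \<phi> (e \<otimes> d) ` K)"
      using E D K
      by (intro compact_UN compact_continuous_image continuous_on_action) auto
    \<comment> \<open>\<open>Y\<close> is closed only relative to \<open>X\<close>; as the
      translates of \<open>K\<close> lie in \<open>X\<close>, intersecting them with the closed set
      \<open>V\<close> gives the same \<open>C\<close>.\<close>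
    moreover obtain V where V: "closed V" "Y = X \<inter> V"
      using closed by (auto simp: closedin_closed)
    moreover have "\<phi> (e \<otimes> d) k \<in> X" if "e \<in> E" "d \<in> D" "k \<in> K" for e d k
      using that E(2) D(2) K(2) by (intro action_closed m_closed) auto
    then have "C = (\<Union>e\<in>E. \<Union>d\<in>D. \<phi> (e \<otimes> d) ` K) \<inter> V"
      unfolding C_def V by blast
    ultimately show ?thesis
      by (simp add: compact_Int_closed)
  qed
  moreover have "(\<Union>h\<in>H. \<phi> h ` C) = Y"
  proof
    show "(\<Union>h\<in>H. \<phi> h ` C) \<subseteq> Y"
      using invariant by (auto simp: C_def)
    show "Y \<subseteq> (\<Union>h\<in>H. \<phi> h ` C)"
    proof
      fix x assume x: "x \<in> Y"
      then obtain z d k where z: "z \<in> carrier G" "\<forall>s\<in>T. z \<otimes> s = s \<otimes> z"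
        and d: "d \<in> D" "k \<in> K" "x = \<phi> z (\<phi> d k)"
        using D(3) unfolding Y_def by blast
      obtain h e where h: "h \<in> H" "e \<in> E" "z = h \<otimes> e"
        using E(3) z by blast
      have cl: "h \<in> carrier G" "e \<in> carrier G" "d \<in> carrier G" "k \<in> X"
        using h d E D K HG by auto
      have "x = \<phi> h (\<phi> (e \<otimes> d) k)"
        using cl by (simp add: d h composition_rule action_closed)
      \<comment> \<open>Invariance of \<open>Y\<close> under \<open>inv h\<close> puts this point
        into \<open>Y\<close>, hence into \<open>C\<close>.\<close>
      moreover from this have "\<phi> (e \<otimes> d) k = \<phi> (inv h) x"
        using cl by (simp add: action_inv action_closed)
      then have "\<phi> (e \<otimes> d) k \<in> Y"
        using invariant_inv(1)[OF h(1) x] by simp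
      then have "\<phi> (e \<otimes> d) k \<in> C"
        unfolding C_def using h d by blast
      ultimately show "x \<in> (\<Union>h\<in>H. \<phi> h ` C)"
        using h by blast
    qed
  qed
  ultimately have "cocompact_on H Y \<phi>"
    unfolding cocompact_on_def using C_def by blast
  moreover have "\<phi> h ` Y = Y" if h: "h \<in> H" for h
  proof
    show "\<phi> h ` Y \<subseteq> Y"
      using invariant[OF h] by blast
    show "Y \<subseteq> \<phi> h ` Y"
    proof
      fix y assume "y \<in> Y"
      with invariant_inv[OF h this] show "y \<in> \<phi> h ` Y"
        by (intro image_eqI[of _ _ "\<phi> (inv h) y"]) auto
    qed
  qed
  ultimately show ?thesis
    unfolding convex_cocompact_def using H(1) closed convex \<open>x0 \<in> Y\<close>
    by (intro conjI exI[of _ Y]) (auto simp: Y_def)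
qed

text \<open>If \<open>h \<otimes> k\<close> centralizes \<open>T\<close>, then so does
  \<open>k\<close>, since \<open>h\<close> commutes with \<open>T\<close>. Hence \<open>k\<close>
  commutes with both factors and is central, and the finite center serves as
  \<open>E\<close>.\<close>

corollary direct_factor_convex_cocompact:
  assumes CAT0: "CAT0 X" and T: "finite T" "T \<subseteq> carrier G" and H: "subgroup H G"
    and commute: "\<And>h k. h \<in> H \<Longrightarrow> k \<in> generate G T \<Longrightarrow> h \<otimes> k = k \<otimes> h"
    and prod: "\<And>g. g \<in> carrier G \<Longrightarrow> \<exists>h\<in>H. \<exists>k\<in>generate G T. g = h \<otimes> k"
    and center: "finite {z \<in> carrier G. \<forall>g\<in>carrier G. z \<otimes> g = g \<otimes> z}"
  shows "convex_cocompact G X \<phi> H"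
proof (rule cofinite_in_centralizer_convex_cocompact[OF CAT0 T H _ center])
  fix z assume z: "z \<in> carrier G" "\<forall>s\<in>T. z \<otimes> s = s \<otimes> z"
  obtain h k where hk: "h \<in> H" "k \<in> generate G T" "z = h \<otimes> k"
    using prod z by blast
  have cl: "h \<in> carrier G" "k \<in> carrier G"
    using hk subgroup.mem_carrier[OF H] generate_in_carrier[OF T(2)] by auto
  \<comment> \<open>The centralizer of \<open>k\<close> is a subgroup, so containing
    \<open>T\<close> it contains all of \<open>generate G T\<close>.\<close>
  define C where "C = {g \<in> carrier G. k \<otimes> g = g \<otimes> k}"
  have "subgroup C G"
  proof
    show "x \<otimes> y \<in> C" if "x \<in> C" "y \<in> C" for x y
      using that cl unfolding C_def by (simp add: m_assoc) (metis m_assoc)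
    show "inv x \<in> C" if "x \<in> C" for x
    proof -
      have x: "x \<in> carrier G" "k \<otimes> x = x \<otimes> k"
        using that by (auto simp: C_def)
      have "k \<otimes> inv x = inv x \<otimes> (x \<otimes> k) \<otimes> inv x"
        using x(1) cl by (simp add: m_assoc[symmetric])
      also have "\<dots> = inv x \<otimes> k"
        unfolding x(2)[symmetric] using x(1) cl by (simp add: m_assoc)
      finally show ?thesis
        using x by (simp add: C_def)
    qed
  qed (use cl in \<open>auto simp: C_def\<close>)
  moreover have "s \<in> C" if s: "s \<in> T" for s
  proof -
    have sG: "s \<in> carrier G"
      using s T by blast
    have "h \<otimes> k \<otimes> s = s \<otimes> (h \<otimes> k)"
      using z(2) s hk(3) by simp
    then have "h \<otimes> (k \<otimes> s) = s \<otimes> h \<otimes> k"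
      using cl sG by (simp add: m_assoc)
    also have "\<dots> = h \<otimes> (s \<otimes> k)"
      unfolding commute[OF hk(1) generate.incl[OF s], symmetric] using cl sG by (simp add: m_assoc)
    finally show ?thesis
      using cl sG by (simp add: C_def)
  qed
  ultimately have T_C: "generate G T \<subseteq> C"
    by (intro generate_subgroup_incl) auto
  have "k \<otimes> g = g \<otimes> k" if "g \<in> carrier G" for g
  proof -
    obtain a b where ab: "a \<in> H" "b \<in> generate G T" "g = a \<otimes> b"
      using prod \<open>g \<in> carrier G\<close> by blast
    have cl': "a \<in> carrier G" "b \<in> carrier G" "k \<otimes> b = b \<otimes> k"
      using ab subgroup.mem_carrier[OF H] T_C by (auto simp: C_def)
    have "k \<otimes> g = (k \<otimes> a) \<otimes> b"
      using ab cl cl' by (simp add: m_assoc)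
    also have "\<dots> = a \<otimes> (k \<otimes> b)"
      unfolding commute[OF ab(1) hk(2), symmetric] using cl cl'(1,2) by (simp add: m_assoc)
    finally show ?thesis
      using ab cl cl' by (simp add: m_assoc)
  qed
  then show "\<exists>h\<in>H. \<exists>e\<in>{z \<in> carrier G. \<forall>g\<in>carrier G. z \<otimes> g = g \<otimes> z}. z = h \<otimes> e"
    using hk cl by blast
qed (auto intro!: commute generate.incl)

end

section \<open>Internal direct products and the conclusion\<close>

lemma internal_direct_product_commute:
  assumes "group G" "internal_direct_product G H K" "h \<in> H" "k \<in> K"
  shows "h \<otimes>\<^bsub>G\<^esub> k = k \<otimes>\<^bsub>G\<^esub> h"
proof -
  interpret group G by fact
  let ?f = "\<lambda>(h, k). h \<otimes>\<^bsub>G\<^esub> k"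
  have sub: "subgroup H G" "subgroup K G"
    and hom: "?f \<in> hom (G\<lparr>carrier := H\<rparr> \<times>\<times> G\<lparr>carrier := K\<rparr>) G"
    using assms(2) by (auto simp: internal_direct_product_def iso_def)
  have cl: "h \<in> carrier G" "k \<in> carrier G" "\<one>\<^bsub>G\<^esub> \<in> H" "\<one>\<^bsub>G\<^esub> \<in> K"
    using sub assms by (auto simp: subgroup.mem_carrier subgroup.one_closed)
  \<comment> \<open>The product of these two pairs is \<open>(h, k)\<close>, so the left side is
    \<open>h\<close> times \<open>k\<close>, while the right side is \<open>k\<close> times
    \<open>h\<close>.\<close>
  have "?f ((\<one>\<^bsub>G\<^esub>, k) \<otimes>\<^bsub>G\<lparr>carrier := H\<rparr> \<times>\<times> G\<lparr>carrier := K\<rparr>\<^esub> (h, \<one>\<^bsub>G\<^esub>)) =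
      ?f (\<one>\<^bsub>G\<^esub>, k) \<otimes>\<^bsub>G\<^esub> ?f (h, \<one>\<^bsub>G\<^esub>)"
    using cl assms(3,4) by (intro hom_mult[OF hom]) (auto simp: DirProd_def)
  then show ?thesis
    using cl by (simp add: DirProd_def)
qed

lemma internal_direct_product_exists:
  assumes "internal_direct_product G H K" "g \<in> carrier G"
  shows "\<exists>h\<in>H. \<exists>k\<in>K. g = h \<otimes>\<^bsub>G\<^esub> k"
proof -
  have "(\<lambda>(h, k). h \<otimes>\<^bsub>G\<^esub> k) ` (H \<times> K) = carrier G"
    using assms(1) by (simp add: internal_direct_product_def iso_def bij_betw_def DirProd_def)
  with assms(2) show ?thesis
    by force
qed

theorem corollary1p5:
  fixes W :: "('w, 'b) monoid_scheme"
    and S S1 S2 :: "'w set"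
    and X :: "'x::metric_space set"
    and \<phi> :: "'w \<Rightarrow> 'x \<Rightarrow> 'x"
  assumes "coxeter_system W S"
    and "S1 \<subseteq> S" and "S2 \<subseteq> S"
    and "internal_direct_product W (parabolic W S1) (parabolic W S2)"
    and "CAT0 X"
    and "acts_geometrically W X \<phi>"
  shows "convex_cocompact W X \<phi> (parabolic W S1) \<and> convex_cocompact W X \<phi> (parabolic W S2)"
proof -
  have "group_action W X \<phi>"
    using assms(6) by (simp add: acts_geometrically_def)
  then interpret geometric_action W X \<phi>
    by (intro geometric_action.intro geometric_action_axioms.intro assms(6))
  have S: "finite S" "S \<subseteq> carrier W"
    using assms(1) by (auto simp: coxeter_system_def has_presentation_def)
  have T: "finite S1" "finite S2" "S1 \<subseteq> carrier W" "S2 \<subseteq> carrier W"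
    using S assms(2,3) finite_subset by auto
  note commute = internal_direct_product_commute[OF is_group assms(4), unfolded parabolic_def]
  note exists = internal_direct_product_exists[OF assms(4), unfolded parabolic_def]
  note center = coxeter_system_finite_center[OF assms(1)]
  have "convex_cocompact W X \<phi> (generate W S1)"
    using direct_factor_convex_cocompact[OF assms(5) T(2,4) generate_is_subgroup[OF T(3)] commute
        exists center] .
  \<comment> \<open>For the second factor the roles of \<open>S1\<close> and \<open>S2\<close> are
    exchanged, which requires the factorization in the opposite order.\<close>
  moreover have "\<exists>h\<in>generate W S2. \<exists>k\<in>generate W S1. g = h \<otimes>\<^bsub>W\<^esub> k" if "g \<in> carrier W" for g
    using exists[OF that] commute by metis
  then have "convex_cocompact W X \<phi> (generate W S2)"
    using direct_factor_convex_cocompact[OF assms(5) T(1,3) generate_is_subgroup[OF T(4)]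
        commute[symmetric] _ center] by blast
  ultimately show ?thesis
    by (simp add: parabolic_def)
qed

end
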